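(* Let $m$ be an odd positive integer, $q=2^m$, and $\gamma\in\mathbb{F}_{2^2}\setminus\mathbb{F}_2$. Let $t$ be a positive integer with $3t\equiv 1\pmod{2^m-1}$. Then the compositional inverse of the permutation polynomial $f_5(x)=x+\gamma\operatorname{Tr}_{q}^{q^2}(x^2+x^{q+2})$ over $\mathbb{F}_{q^2}$ is $$f_5^{-1}(x)=\operatorname{Tr}_q^{q^2}((1+\gamma)x)+\gamma\Big[\big\{\operatorname{Tr}_q^{q^2}(x)+(\operatorname{Tr}_q^{q^2}((1+\gamma)x))^3+(\operatorname{Tr}_q^{q^2}((1+\gamma)x))^2+\operatorname{Tr}_q^{q^2}((1+\gamma)x)+1\big\}^t+\operatorname{Tr}_q^{q^2}((1+\gamma)x)+1\Big].$$
   Context: $\mathbb{F}_{q^2}$ is the finite field with $q^2$ elements, and $\mathbb{F}_q$, $\mathbb{F}_{2^2}$, $\mathbb{F}_2$ denote its subfields with $q$, $4$ and $2$ elements. $\operatorname{Tr}_q^{q^2}(z)=z+z^q$ for $z\in\mathbb{F}_{q^2}$. A polynomial $f\in\mathbb{F}_{q^2}[x]$ is a permutation polynomial over $\mathbb{F}_{q^2}$ if the map $a\mapsto f(a)$ is a bijection of $\mathbb{F}_{q^2}$. Its compositional inverse $f^{-1}$ is the polynomial $g$ (polynomials being identified with the maps $\mathbb{F}_{q^2}\to\mathbb{F}_{q^2}$ they induce) such that $f(g(x))=g(f(x))=x$ for every $x\in\mathbb{F}_{q^2}$. *)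

theory Defs
  imports
    "HOL-Computational_Algebra.Computational_Algebra"
    "HOL-Number_Theory.Cong"
    "HOL-Library.Cardinality"
begin

definition is_subfield :: "'a::field set \<Rightarrow> bool" where
  "is_subfield K \<longleftrightarrow>
     0 \<in> K \<and> 1 \<in> K \<and>
     (\<forall>a\<in>K. \<forall>b\<in>K. a - b \<in> K \<and> a * b \<in> K) \<and>
     (\<forall>a\<in>K. inverse a \<in> K)"

definition permutation_polynomial :: "'a::field poly \<Rightarrow> bool" where
  "permutation_polynomial f \<longleftrightarrow> bij (poly f)"

text \<open>Polynomials count only through the maps they induce: over a finite field, \<open>g\<close> is
  determined by this relation up to adding multiples of \<open>x\<^sup>n - x\<close>, \<open>n\<close> the order of the field.\<close>

definition compositional_inverse :: "'a::field poly \<Rightarrow> 'a poly \<Rightarrow> bool" where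
  "compositional_inverse f g \<longleftrightarrow>
     (\<forall>x. poly f (poly g x) = x \<and> poly g (poly f x) = x)"

text \<open>The relative trace \<open>z + z\<^sup>q\<close> is applied to polynomials; evaluating \<open>Tr q p\<close> at \<open>a\<close> gives
  \<open>z + z\<^sup>q\<close> for \<open>z = poly p a\<close>.\<close>

definition Tr :: "nat \<Rightarrow> 'a::field poly \<Rightarrow> 'a poly" where
  "Tr q p = p + p ^ q"

abbreviation X :: "'a::field poly" where
  "X \<equiv> [:0, 1:]"

definition f5 :: "nat \<Rightarrow> 'a::field \<Rightarrow> 'a poly" where
  "f5 q \<gamma> = X + smult \<gamma> (Tr q (X ^ 2 + X ^ (q + 2)))"

definition f5_inv :: "nat \<Rightarrow> 'a::field \<Rightarrow> nat \<Rightarrow> 'a poly" where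
  "f5_inv q \<gamma> t =
     Tr q (smult (1 + \<gamma>) X) +
     smult \<gamma>
       ((Tr q X + (Tr q (smult (1 + \<gamma>) X)) ^ 3 + (Tr q (smult (1 + \<gamma>) X)) ^ 2
          + Tr q (smult (1 + \<gamma>) X) + 1) ^ t
        + Tr q (smult (1 + \<gamma>) X) + 1)"

end

theory Submission
  imports Defs
begin

text \<open>
  Write \<open>T(z) = z + z\<^sup>q\<close>. The field has characteristic \<open>2\<close>, \<open>\<gamma>\<^sup>2 = \<gamma> + 1\<close>, and
  since \<open>m\<close> is odd the Frobenius map \<open>z \<mapsto> z\<^sup>q\<close> moves \<open>\<gamma>\<close> to its conjugate \<open>\<gamma> + 1\<close>. So
  \<open>1, \<gamma>\<close> is a basis of the field over the fixed field of Frobenius, and the coordinates of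
  \<open>x = a + \<gamma> b\<close> in it are traces: \<open>a = T((1 + \<gamma>) x)\<close> and \<open>b = T(x)\<close>
  (\<open>basis_expansion\<close>, \<open>trace_coordinates\<close>).

  The norm of \<open>x\<close> is \<open>x\<^sup>q\<^sup>+\<^sup>1 = a\<^sup>2 + a b + b\<^sup>2\<close>, so \<open>T(x\<^sup>2 + x\<^sup>q\<^sup>+\<^sup>2) = b\<^sup>2 + (a\<^sup>2 + a b + b\<^sup>2) b\<close>
  and the polynomial sends \<open>a + \<gamma> b\<close> to \<open>a + \<gamma> b'\<close>, where
  \<open>b' = b + b\<^sup>2 + a\<^sup>2 b + a b\<^sup>2 + b\<^sup>3 = (b + a + 1)\<^sup>3 + (a + 1)\<^sup>3\<close>.
  The first coordinate is thus kept, and the second undergoes a cubing composed with translations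
  that depend on \<open>a\<close> alone (\<open>poly_f5_coordinates\<close>). Because \<open>3 t \<equiv> 1\<close> modulo \<open>q - 1\<close>, the
  \<open>t\<close>-th power undoes cubing on the fixed field, whence
  \<open>b = (b' + a\<^sup>3 + a\<^sup>2 + a + 1)\<^sup>t + a + 1\<close>, and this is the claimed inverse written in
  coordinates (\<open>poly_f5_inv_coordinates\<close>).
\<close>

section \<open>The subfields of order two and four\<close>

lemma subfield_card_2:
  fixes K :: "'a::field set"
  assumes "is_subfield K" and "card K = 2"
  shows "K = {0, 1}"
proof -
  have "finite K"
    using assms(2) by (simp add: card_ge_0_finite)
  moreover have "{0, 1} \<subseteq> K"
    using assms(1) by (simp add: is_subfield_def)
  ultimately show ?thesis
    using assms(2) by (intro card_subset_eq[symmetric]) auto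
qed

lemma CHAR_eq_2_if_subfield_card_2:
  fixes K :: "'a::finite_field set"
  assumes "is_subfield K" and "card K = 2"
  shows "CHAR('a) = 2"
proof -
  have "0 - 1 \<in> K"
    using assms(1) by (auto simp: is_subfield_def)
  then have "(0 - 1 :: 'a) = 0 \<or> (0 - 1 :: 'a) = 1"
    using subfield_card_2[OF assms] by blast
  then have "(- 1 :: 'a) = 1"
    by simp
  then have "of_nat 2 = (0 :: 'a)"
    by (metis add.right_inverse of_nat_1 of_nat_add one_add_one)
  then have "CHAR('a) dvd 2"
    by (simp only: of_nat_eq_0_iff_char_dvd)
  moreover have "prime CHAR('a)"
    by (intro prime_CHAR_semidom finite_imp_CHAR_pos) simp
  ultimately show ?thesis
    by (metis primes_dvd_imp_eq two_is_prime_nat)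
qed

lemma char_2_double:
  fixes x y :: "'a::field"
  assumes "CHAR('a) = 2"
  shows "x + x = 0" and "x + (x + y) = y" and "(2::'a) = 0"
proof -
  show cancel: "z + z = 0" for z :: 'a
    using assms by (metis add.right_inverse uminus_CHAR_2)
  show "x + (x + y) = y"
    by (metis add.assoc add_0 cancel)
  show "(2::'a) = 0"
    by (metis cancel one_add_one)
qed

text \<open>Powers are expanded into products as well, so that equal monomials meet syntactically and
  cancel in pairs by \<open>char_2_double\<close>.\<close>
lemmas char_2_expand =
  distrib_left distrib_right power2_eq_square power3_eq_cube ac_simps

text \<open>The subfield has no room for elements other than \<open>0\<close>, \<open>1\<close>, \<open>\<gamma>\<close> and \<open>\<gamma> + 1\<close>, and the
  square of \<open>\<gamma>\<close> cannot be one of the first three.\<close>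
lemma subfield_card_4_square:
  fixes \<gamma> :: "'a::field" and K :: "'a set"
  assumes char: "CHAR('a) = 2" and K: "is_subfield K" "card K = 4"
    and \<gamma>: "\<gamma> \<in> K" "\<gamma> \<noteq> 0" "\<gamma> \<noteq> 1"
  shows "\<gamma>\<^sup>2 = \<gamma> + 1"
proof -
  note double = char_2_double[OF char]
  have "\<gamma> - 1 \<in> K" "\<gamma> * \<gamma> \<in> K"
    using K(1) \<gamma>(1) by (auto simp: is_subfield_def)
  then have mem: "\<gamma> + 1 \<in> K" "\<gamma>\<^sup>2 \<in> K"
    by (simp_all add: power2_eq_square minus_CHAR_2[OF char])
  have "\<gamma> + 1 \<noteq> 0"
    using \<gamma>(3) double by (metis add.right_neutral)
  then have "card {0, 1, \<gamma>, \<gamma> + 1} = 4"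
    using \<gamma>(2,3) by auto
  moreover have "{0, 1, \<gamma>, \<gamma> + 1} \<subseteq> K"
    using K(1) \<gamma>(1) mem(1) by (simp add: is_subfield_def)
  moreover have "finite K"
    using K(2) by (simp add: card_ge_0_finite)
  ultimately have "K = {0, 1, \<gamma>, \<gamma> + 1}"
    using K(2) card_subset_eq by metis
  moreover have "\<gamma>\<^sup>2 \<noteq> 1"
  proof
    assume "\<gamma>\<^sup>2 = 1"
    then have "(\<gamma> + 1) * (\<gamma> + 1) = 0"
      by (simp add: double char_2_expand)
    then show False
      using \<open>\<gamma> + 1 \<noteq> 0\<close> by simp
  qed
  ultimately show ?thesis
    using mem(2) \<gamma>(2,3) by (auto simp: power2_eq_square)
qed

text \<open>Squaring swaps \<open>\<gamma>\<close> and \<open>\<gamma> + 1\<close>, and an odd number of squarings still does.\<close>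
lemma conjugate_of_generator:
  fixes \<gamma> :: "'a::field"
  assumes char: "CHAR('a) = 2" and \<gamma>: "\<gamma>\<^sup>2 = \<gamma> + 1" and "odd m"
  shows "\<gamma> ^ (2 ^ m) = \<gamma> + 1"
proof -
  note double = char_2_double[OF char]
  have sq: "(\<gamma> + 1)\<^sup>2 = \<gamma>"
    using \<gamma> by (simp add: double char_2_expand)
  have "\<gamma> ^ (2 ^ (2 * k + 1)) = \<gamma> + 1" for k :: nat
  proof (induction k)
    case 0
    then show ?case using \<gamma> by simp
  next
    case (Suc k)
    have "(2::nat) ^ (2 * Suc k + 1) = 2 ^ (2 * k + 1) * 2 * 2"
      by simp
    then have "\<gamma> ^ (2 ^ (2 * Suc k + 1)) = ((\<gamma> ^ (2 ^ (2 * k + 1)))\<^sup>2)\<^sup>2"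
      by (simp only: power_mult)
    also have "\<dots> = \<gamma> + 1"
      by (simp only: Suc.IH sq \<gamma>)
    finally show ?case .
  qed
  then show ?thesis
    using \<open>odd m\<close> by (metis oddE)
qed

section \<open>Trace coordinates\<close>

definition trace :: "nat \<Rightarrow> 'a::field \<Rightarrow> 'a" where
  "trace q z = z + z ^ q"

lemma poly_Tr: "poly (Tr q p) x = trace q (poly p x)"
  by (simp add: Tr_def trace_def)

lemma poly_f5: "poly (f5 q \<gamma>) x = x + \<gamma> * trace q (x\<^sup>2 + x ^ (q + 2))"
  by (simp add: f5_def poly_Tr)

lemma poly_f5_inv:
  "poly (f5_inv q \<gamma> t) x =
     trace q ((1 + \<gamma>) * x) +
     \<gamma> * ((trace q x + trace q ((1 + \<gamma>) * x) ^ 3 + (trace q ((1 + \<gamma>) * x))\<^sup>2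
            + trace q ((1 + \<gamma>) * x) + 1) ^ t
          + trace q ((1 + \<gamma>) * x) + 1)"
  by (simp add: f5_inv_def poly_Tr mult.commute)

lemma power_q_add:
  fixes x y :: "'a::field"
  assumes "CHAR('a) = 2" and "q = 2 ^ m"
  shows "(x + y) ^ q = x ^ q + y ^ q"
  using assms by (intro freshmans_dream'[of q m]) auto

text \<open>The trace lands in the fixed field because Frobenius swaps its two summands.\<close>
lemma trace_fixed:
  fixes z :: "'a::finite_field"
  assumes "CHAR('a) = 2" and "q = 2 ^ m" and "CARD('a) = q ^ 2"
  shows "trace q z ^ q = trace q z"
proof -
  have "(z ^ q) ^ q = z ^ CARD('a)"
    by (simp add: assms(3) power2_eq_square flip: power_mult)
  then have "(z ^ q) ^ q = z"
    by (simp add: finite_field_power_card_eq_same)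
  then show ?thesis
    by (simp add: trace_def power_q_add[OF assms(1,2)] add.commute)
qed

lemma basis_expansion:
  fixes \<gamma> z :: "'a::field"
  assumes char: "CHAR('a) = 2" and \<gamma>: "\<gamma>\<^sup>2 = \<gamma> + 1" "\<gamma> ^ q = \<gamma> + 1" and q: "q = 2 ^ m"
  shows "z = trace q ((1 + \<gamma>) * z) + \<gamma> * trace q z"
proof -
  note double = char_2_double[OF char]
  have "(1 + \<gamma>) ^ q = \<gamma>"
    using \<gamma>(2) by (simp add: double power_q_add[OF char q] ac_simps)
  then show ?thesis
    unfolding trace_def power_mult_distrib by (simp add: double char_2_expand)
qed

lemma trace_coordinates:
  fixes \<gamma> a b :: "'a::field"
  assumes char: "CHAR('a) = 2" and \<gamma>: "\<gamma>\<^sup>2 = \<gamma> + 1" "\<gamma> ^ q = \<gamma> + 1" and q: "q = 2 ^ m"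
    and fixed: "a ^ q = a" "b ^ q = b"
  shows "trace q (a + \<gamma> * b) = b" and "trace q ((1 + \<gamma>) * (a + \<gamma> * b)) = a"
proof -
  note double = char_2_double[OF char]
  have frob: "(a + \<gamma> * b) ^ q = a + (\<gamma> + 1) * b"
    using fixed \<gamma>(2) by (simp add: power_q_add[OF char q] power_mult_distrib)
  show b: "trace q (a + \<gamma> * b) = b"
    unfolding trace_def frob by (simp add: double char_2_expand)
  show "trace q ((1 + \<gamma>) * (a + \<gamma> * b)) = a"
    using basis_expansion[OF char \<gamma> q, of "a + \<gamma> * b"] by (simp add: b)
qed

section \<open>The polynomial and its inverse in coordinates\<close>

text \<open>Multiplying \<open>x\<close> by its norm \<open>N\<close>, which is fixed by Frobenius, scales both coordinates, so
  those of \<open>x\<^sup>2 + x\<^sup>q\<^sup>+\<^sup>2 = x\<^sup>2 + N x\<close> are visible and its trace is the second one.\<close>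
lemma poly_f5_coordinates:
  fixes \<gamma> a b :: "'a::field"
  assumes char: "CHAR('a) = 2" and \<gamma>: "\<gamma>\<^sup>2 = \<gamma> + 1" "\<gamma> ^ q = \<gamma> + 1" and q: "q = 2 ^ m"
    and fixed: "a ^ q = a" "b ^ q = b"
  shows "poly (f5 q \<gamma>) (a + \<gamma> * b) = a + \<gamma> * ((b + a + 1) ^ 3 + (a + 1) ^ 3)"
proof -
  note double = char_2_double[OF char]
  define x N where "x = a + \<gamma> * b" and "N = a\<^sup>2 + a * b + b\<^sup>2"
  have \<gamma>_sq: "\<gamma> * \<gamma> = \<gamma> + 1" "\<gamma> * (\<gamma> * c) = \<gamma> * c + c" for c
    using \<gamma>(1) by (simp_all add: power2_eq_square distrib_right flip: mult.assoc)
  have frob: "x ^ q = a + (\<gamma> + 1) * b"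
    using fixed \<gamma>(2) by (simp add: x_def power_q_add[OF char q] power_mult_distrib)
  have norm: "x ^ q * x = N"
    unfolding frob by (simp add: double x_def N_def char_2_expand \<gamma>_sq)
  have "x ^ (q + 2) = x ^ q * x * x"
    by (simp add: power_add power2_eq_square)
  also have "\<dots> = N * a + \<gamma> * (N * b)"
    by (simp only: norm) (simp add: x_def algebra_simps)
  finally have "x\<^sup>2 + x ^ (q + 2) = (a\<^sup>2 + b\<^sup>2 + N * a) + \<gamma> * (b\<^sup>2 + N * b)"
    by (simp add: double x_def char_2_expand \<gamma>_sq)
  moreover have "N ^ q = N"
    using fixed by (simp add: N_def power_q_add[OF char q] power_mult_distrib power2_eq_square)
  then have "(a\<^sup>2 + b\<^sup>2 + N * a) ^ q = a\<^sup>2 + b\<^sup>2 + N * a" "(b\<^sup>2 + N * b) ^ q = b\<^sup>2 + N * b"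
    using fixed by (simp_all add: power_q_add[OF char q] power_mult_distrib power2_eq_square)
  ultimately have "trace q (x\<^sup>2 + x ^ (q + 2)) = b\<^sup>2 + N * b"
    using trace_coordinates(1)[OF char \<gamma> q] by simp
  then have "poly (f5 q \<gamma>) x = a + \<gamma> * (b + (b\<^sup>2 + N * b))"
    by (simp add: poly_f5 x_def distrib_left)
  also have "b + (b\<^sup>2 + N * b) = (b + a + 1) ^ 3 + (a + 1) ^ 3"
    by (simp add: double N_def char_2_expand)
  finally show ?thesis
    by (simp add: x_def)
qed

lemma poly_f5_inv_coordinates:
  fixes \<gamma> a b :: "'a::field"
  assumes char: "CHAR('a) = 2" and \<gamma>: "\<gamma>\<^sup>2 = \<gamma> + 1" "\<gamma> ^ q = \<gamma> + 1" and q: "q = 2 ^ m"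
    and fixed: "a ^ q = a" "b ^ q = b"
  shows "poly (f5_inv q \<gamma> t) (a + \<gamma> * b) = a + \<gamma> * ((b + (a + 1) ^ 3) ^ t + a + 1)"
proof -
  have "b + a ^ 3 + a\<^sup>2 + a + 1 = b + (a + 1) ^ 3"
    by (simp add: char_2_double[OF char] char_2_expand)
  then show ?thesis
    by (simp only: poly_f5_inv trace_coordinates[OF char \<gamma> q fixed])
qed

text \<open>A fixed \<open>c\<close> satisfies \<open>c \<cdot> c\<^sup>q\<^sup>-\<^sup>1 = c\<close>, and \<open>3 t = 1 + k (q - 1)\<close>. The assumption \<open>t > 0\<close>
  covers \<open>q = 2\<close>, where the congruence is void and \<open>t = 0\<close> would turn \<open>c = 0\<close> into \<open>1\<close>.\<close>
lemma cube_power_t: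
  fixes c :: "'a::field"
  assumes "c ^ q = c" and "q > 0" and "t > 0" and "[3 * t = 1] (mod (q - 1))"
  shows "c ^ (3 * t) = c"
proof -
  obtain k where k: "3 * t = 1 + k * (q - 1)"
    using assms(3,4) unfolding cong_to_1'_nat by auto
  have "c ^ (1 + k * (q - 1)) = c"
  proof (induction k)
    case (Suc k)
    have "1 + Suc k * (q - 1) = (1 + k * (q - 1)) + (q - 1)"
      by simp
    then have "c ^ (1 + Suc k * (q - 1)) = c * c ^ (q - 1)"
      by (metis Suc.IH power_add)
    also have "\<dots> = c"
      using assms(1,2) by (metis power_eq_if less_irrefl)
    finally show ?case .
  qed simp
  then show ?thesis
    by (simp add: k)
qed

theorem theorem3p5:
  fixes \<gamma> :: "'a::finite_field" and F\<^sub>2 F\<^sub>4 :: "'a set" and m q t :: nat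
  assumes "odd m" and "m > 0" and "q = 2 ^ m"
    and "CARD('a) = q ^ 2"
    and "is_subfield F\<^sub>2" and "card F\<^sub>2 = 2"
    and "is_subfield F\<^sub>4" and "card F\<^sub>4 = 4"
    and "\<gamma> \<in> F\<^sub>4 - F\<^sub>2"
    and "t > 0" and "[3 * t = 1] (mod (2 ^ m - 1))"
  shows "permutation_polynomial (f5 q \<gamma>) \<and>
         compositional_inverse (f5 q \<gamma>) (f5_inv q \<gamma> t)"
proof -
  have char: "CHAR('a) = 2"
    using assms(5,6) by (rule CHAR_eq_2_if_subfield_card_2)
  note double = char_2_double[OF char]
  have "\<gamma> \<in> F\<^sub>4" "\<gamma> \<noteq> 0" "\<gamma> \<noteq> 1"
    using assms(9) subfield_card_2[OF assms(5,6)] by auto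
  then have \<gamma>: "\<gamma>\<^sup>2 = \<gamma> + 1"
    by (rule subfield_card_4_square[OF char assms(7,8)])
  have \<gamma>_q: "\<gamma> ^ q = \<gamma> + 1"
    using conjugate_of_generator[OF char \<gamma> assms(1)] by (simp add: assms(3))
  note frob_add = power_q_add[OF char assms(3)]
  have fixed_power: "(c ^ n) ^ q = c ^ n" if "c ^ q = c" for c :: 'a and n
    using that by (metis mult.commute power_mult)
  have root: "c ^ (3 * t) = c" if "c ^ q = c" for c :: 'a
    using that assms(3,10,11) by (intro cube_power_t[of c q]) auto
  have inverse_both: "poly (f5 q \<gamma>) (poly (f5_inv q \<gamma> t) x) = x \<and>
      poly (f5_inv q \<gamma> t) (poly (f5 q \<gamma>) x) = x" for x
  proof -
    define a b where "a = trace q ((1 + \<gamma>) * x)" and "b = trace q x"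
    have a: "a ^ q = a" and b: "b ^ q = b"
      unfolding a_def b_def by (rule trace_fixed[OF char assms(3,4)])+
    have x: "x = a + \<gamma> * b"
      unfolding a_def b_def by (rule basis_expansion[OF char \<gamma> \<gamma>_q assms(3)])
    have a1: "(a + 1) ^ q = a + 1"
      using a by (simp add: frob_add)
    let ?b' = "(b + a + 1) ^ 3 + (a + 1) ^ 3" and ?c = "(b + (a + 1) ^ 3) ^ t"
    have b': "?b' ^ q = ?b'"
      using a b by (simp add: frob_add fixed_power)
    have c: "?c ^ q = ?c" "(?c + a + 1) ^ q = ?c + a + 1"
      using a b a1 by (simp_all add: frob_add fixed_power)
    have "poly (f5_inv q \<gamma> t) (poly (f5 q \<gamma>) x) =
        a + \<gamma> * ((?b' + (a + 1) ^ 3) ^ t + a + 1)"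
      unfolding x poly_f5_coordinates[OF char \<gamma> \<gamma>_q assms(3) a b]
      by (rule poly_f5_inv_coordinates[OF char \<gamma> \<gamma>_q assms(3) a b'])
    also have "(?b' + (a + 1) ^ 3) ^ t = (b + a + 1) ^ (3 * t)"
      by (simp add: add.assoc double power_mult)
    also have "\<dots> = b + a + 1"
      using a b by (intro root) (simp add: frob_add)
    also have "b + a + 1 + a + 1 = b"
      by (simp add: double ac_simps)
    finally have left: "poly (f5_inv q \<gamma> t) (poly (f5 q \<gamma>) x) = x"
      by (simp add: x)
    have "poly (f5 q \<gamma>) (poly (f5_inv q \<gamma> t) x) =
        a + \<gamma> * ((?c + a + 1 + a + 1) ^ 3 + (a + 1) ^ 3)"
      unfolding x poly_f5_inv_coordinates[OF char \<gamma> \<gamma>_q assms(3) a b]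
      by (rule poly_f5_coordinates[OF char \<gamma> \<gamma>_q assms(3) a c(2)])
    also have "?c + a + 1 + a + 1 = ?c"
      using double by (metis (no_types) add.assoc add.commute)
    also have "?c ^ 3 = (b + (a + 1) ^ 3) ^ (3 * t)"
      by (simp add: mult.commute flip: power_mult)
    also have "\<dots> = b + (a + 1) ^ 3"
      using b a1 by (intro root) (simp add: frob_add fixed_power)
    also have "b + (a + 1) ^ 3 + (a + 1) ^ 3 = b"
      by (simp add: add.assoc double)
    finally have "poly (f5 q \<gamma>) (poly (f5_inv q \<gamma> t) x) = x"
      by (simp add: x)
    with left show ?thesis by blast
  qed
  then have "bij (poly (f5 q \<gamma>))"
    by (intro o_bij[of "poly (f5_inv q \<gamma> t)"]) (auto simp: fun_eq_iff)
  with inverse_both show ?thesis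
    by (simp add: permutation_polynomial_def compositional_inverse_def)
qed

end
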